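(* Let $\alpha\in(0,1]$ and let $G$ be a graph on $n$ vertices with at least $\alpha\binom{n}{2}$ edges. If $G$ does not contain $K_{2,2}$ as an induced subgraph, then $\omega(G)\geq (1-\sqrt{1-\alpha})^2\,n$.
   Context: $\omega(G)$ denotes the maximum number of vertices of a clique (complete subgraph) in $G$. $K_{2,2}$ is the complete bipartite graph with two vertices on each side (a 4-cycle); $G$ contains it as an induced subgraph if there are four vertices of $G$ whose induced subgraph is a 4-cycle. *)

theory Defs
  imports Complex_Main "Graph_Theory.Graph_Theory"
begin

text \<open>
  A finite simple graph is an instance of the locale \<^locale>\<open>graph\<close>: a finite, loop-free
  digraph without parallel arcs whose arc relation is symmetric.  Each undirected edge is therefore
  represented by two opposite arcs, and edges have to be counted as unordered pairs of end points.
\<close>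

definition edge_set :: "('a, 'b) pre_digraph \<Rightarrow> 'a set set" where
  "edge_set G = {{u, v} | u v. u \<rightarrow>\<^bsub>G\<^esub> v}"

definition clique_number :: "('a, 'b) pre_digraph \<Rightarrow> nat" where
  "clique_number G = Max {k. \<exists>H. subgraph H G \<and> K\<^bsub>k\<^esub> H}"

text \<open>For a finite graph the maximum is taken over a finite nonempty set.\<close>

lemma (in graph) finite_clique_sizes: "finite {k. \<exists>H. subgraph H G \<and> K\<^bsub>k\<^esub> H}"
proof (rule finite_subset)
  show "{k. \<exists>H. subgraph H G \<and> K\<^bsub>k\<^esub> H} \<subseteq> {..card (verts G)}"
    by (auto simp: subgraph_def complete_digraph_def intro: card_mono)
qed simp

lemma (in graph) zero_in_clique_sizes: "0 \<in> {k. \<exists>H. subgraph H G \<and> K\<^bsub>k\<^esub> H}"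
proof -
  have "subgraph (G \<restriction> {}) G"
    using induced_induce[of "{}"] by (auto simp: induced_subgraph_def)
  moreover have "graph (G \<restriction> {})"
    by unfold_locales (auto simp: symmetric_def arcs_ends_def sym_def)
  then have "K\<^bsub>0\<^esub> (G \<restriction> {})"
    by (simp add: complete_digraph_def arcs_ends_def)
  ultimately show ?thesis by blast
qed

end

theory Submission
  imports Defs "HOL-Analysis.Convex"
begin

text \<open>
  Write \<open>\<omega>\<close> for the clique number and \<open>s = sqrt (1 - \<alpha>)\<close>.  Inside the neighbourhood of a vertex \<open>v\<close>,
  take a maximal family of \<open>m v\<close> disjoint non-edges.  The uncovered neighbours form, together
  with \<open>v\<close>, a clique, so \<open>degree v + 1 \<le> \<omega> + 2 * m v\<close>.  Any two members of the family are joined by a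
  further non-edge, since otherwise they would span an induced 4-cycle; hence \<open>v\<close> is a common
  neighbour of at least \<open>(m v)\<^sup>2\<close> ordered non-adjacent pairs.  Conversely, the common neighbours of
  a non-adjacent pair form a clique, so \<open>(\<Sum>v. (m v)\<^sup>2) \<le> \<omega> * (1 - \<alpha>) * n * (n - 1)\<close>.  Summing
  the degree inequality and applying Cauchy-Schwarz gives
  \<open>\<alpha> * n \<le> \<omega> + 2 * s * sqrt (\<omega> * n)\<close>, that is \<open>n \<le> (sqrt \<omega> + s * sqrt n)\<^sup>2\<close>.
\<close>

text \<open>Pairs are ordered, so each non-edge counts twice, in line with \<open>arcs_ends\<close>,
  where each edge counts twice.\<close>

definition nonadjacent_pairs :: "('a, 'b) pre_digraph \<Rightarrow> 'a set \<Rightarrow> ('a \<times> 'a) set" where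
  "nonadjacent_pairs G S = {(x, y). x \<in> S \<and> y \<in> S \<and> x \<noteq> y \<and> \<not> x \<rightarrow>\<^bsub>G\<^esub> y}"

lemma finite_nonadjacent_pairs: "finite S \<Longrightarrow> finite (nonadjacent_pairs G S)"
  by (rule finite_subset[of _ "S \<times> S"]) (auto simp: nonadjacent_pairs_def)

context graph
begin

section \<open>Adjacency, cliques and induced 4-cycles\<close>

lemma adj_commute: "u \<rightarrow>\<^bsub>G\<^esub> v \<longleftrightarrow> v \<rightarrow>\<^bsub>G\<^esub> u"
  using arcs_ends_symmetric[OF sym_arcs] by blast

lemma not_adj_self: "\<not> u \<rightarrow>\<^bsub>G\<^esub> u"
  using adj_not_same by blast

lemma graph_induce_subgraph:
  assumes "S \<subseteq> verts G"
  shows "graph (G \<restriction> S)"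
proof -
  have ind: "induced_subgraph (G \<restriction> S) G"
    using assms by (rule induced_induce)
  interpret H: wf_digraph "G \<restriction> S"
    by (rule wellformed_induce_subgraph)
  have "finite S" using assms finite_verts by (rule finite_subset)
  then show ?thesis
    using induced_graph_imp_symmetric[OF sym_arcs ind] no_loops no_multi_arcs
    by unfold_locales (auto simp: arc_to_ends_def)
qed

lemma arcs_ends_induce_subgraph:
  "arcs_ends (G \<restriction> S) = {(u, v). u \<in> S \<and> v \<in> S \<and> u \<rightarrow>\<^bsub>G\<^esub> v}"
  by (auto simp: arcs_ends_conv)

lemma card_clique_le_clique_number:
  assumes "C \<subseteq> verts G" and "pairwise (\<lambda>u v. u \<rightarrow>\<^bsub>G\<^esub> v) C"
  shows "card C \<le> clique_number G"
proof -
  have "K\<^bsub>card C\<^esub> (G \<restriction> C)"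
    unfolding complete_digraph_def
    using graph_induce_subgraph[OF assms(1)] assms(2)
    by (auto simp: arcs_ends_induce_subgraph pairwise_def not_adj_self)
  moreover have "subgraph (G \<restriction> C) G"
    using induced_induce[OF assms(1)] by (simp add: induced_subgraph_def)
  ultimately show ?thesis
    unfolding clique_number_def using finite_clique_sizes by (intro Max_ge) auto
qed

text \<open>The four adjacencies keep the sides \<open>{a, b}\<close> and \<open>{c, d}\<close>
  disjoint, since there are no loops. It is used contrapositively: for two disjoint non-edges, and
  for two common neighbours of a non-adjacent pair.\<close>

lemma induced_K22:
  assumes "a \<noteq> b" "c \<noteq> d" "\<not> a \<rightarrow>\<^bsub>G\<^esub> b" "\<not> c \<rightarrow>\<^bsub>G\<^esub> d"
    and "a \<rightarrow>\<^bsub>G\<^esub> c" "a \<rightarrow>\<^bsub>G\<^esub> d" "b \<rightarrow>\<^bsub>G\<^esub> c" "b \<rightarrow>\<^bsub>G\<^esub> d"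
  shows "\<exists>H. induced_subgraph H G \<and> K\<^bsub>2,2\<^esub> H"
proof -
  let ?S = "{a, b} \<union> {c, d}"
  have sub: "?S \<subseteq> verts G"
    using assms(5-8) by (auto dest: adj_in_verts)
  have ne: "a \<noteq> c" "a \<noteq> d" "b \<noteq> c" "b \<noteq> d"
    using assms(5-8) not_adj_self by auto
  have ends: "arcs_ends (G \<restriction> ?S) = {a, b} \<times> {c, d} \<union> {c, d} \<times> {a, b}"
    using assms(3-8) by (auto simp: arcs_ends_induce_subgraph not_adj_self adj_commute)
  have parts: "{a, b} \<inter> {c, d} = {}" "card {a, b} = 2" "card {c, d} = 2"
    using ne assms(1,2) by auto
  have "\<exists>U V. verts (G \<restriction> ?S) = U \<union> V \<and> U \<inter> V = {} \<and> card U = 2 \<and> card V = 2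
      \<and> arcs_ends (G \<restriction> ?S) = U \<times> V \<union> V \<times> U"
    by (rule exI[of _ "{a, b}"], rule exI[of _ "{c, d}"], intro conjI)
      (rule induce_subgraph_verts parts ends)+
  then have "K\<^bsub>2,2\<^esub> (G \<restriction> ?S)"
    unfolding complete_bipartite_digraph_def using graph_induce_subgraph[OF sub] by (intro conjI)
  then show ?thesis
    using induced_induce[OF sub] by blast
qed

section \<open>Counting edges and non-adjacent pairs\<close>

lemma two_card_edge_set: "2 * card (edge_set G) = card (arcs_ends G)"
proof -
  let ?B = "\<lambda>e. {p \<in> arcs_ends G. {fst p, snd p} = e}"
  have fin: "finite (arcs_ends G)" by (simp add: arcs_ends_def)
  have img: "edge_set G = (\<lambda>p. {fst p, snd p}) ` arcs_ends G"
    by (force simp: edge_set_def)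
  have "card (?B e) = 2" if "e \<in> edge_set G" for e
  proof -
    from that obtain u v where uv: "e = {u, v}" "u \<rightarrow>\<^bsub>G\<^esub> v"
      by (auto simp: edge_set_def)
    then have "?B e = {(u, v), (v, u)}" and "u \<noteq> v"
      using adj_commute[of u v] not_adj_self by (auto simp: doubleton_eq_iff)
    then show ?thesis by simp
  qed
  then have "(\<Sum>e\<in>edge_set G. card (?B e)) = 2 * card (edge_set G)"
    by simp
  moreover have "card (arcs_ends G) = (\<Sum>e\<in>edge_set G. card (?B e))"
    unfolding img using sum.image_gen[OF fin, of "\<lambda>_. 1::nat" "\<lambda>p. {fst p, snd p}"] by simp
  ultimately show ?thesis by simp
qed

lemma sum_card_neighbours: "(\<Sum>v\<in>verts G. card {u. v \<rightarrow>\<^bsub>G\<^esub> u}) = card (arcs_ends G)"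
proof -
  have "finite {u. v \<rightarrow>\<^bsub>G\<^esub> u}" for v
    by (rule finite_subset[OF _ finite_verts]) (auto dest: adj_in_verts)
  then have "(\<Sum>v\<in>verts G. card {u. v \<rightarrow>\<^bsub>G\<^esub> u}) = card (SIGMA v:verts G. {u. v \<rightarrow>\<^bsub>G\<^esub> u})"
    by (subst card_SigmaI) auto
  also have "(SIGMA v:verts G. {u. v \<rightarrow>\<^bsub>G\<^esub> u}) = arcs_ends G"
    by (auto dest: adj_in_verts)
  finally show ?thesis .
qed

text \<open>The two sets partition the ordered pairs of distinct vertices.\<close>

lemma card_arcs_ends_nonadjacent_pairs:
  "card (arcs_ends G) + card (nonadjacent_pairs G (verts G)) = card (verts G) * (card (verts G) - 1)"
proof -
  let ?V = "verts G"
  have fin: "finite (arcs_ends G)" by (simp add: arcs_ends_def)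
  have "card (arcs_ends G) + card (nonadjacent_pairs G ?V)
      = card (arcs_ends G \<union> nonadjacent_pairs G ?V)"
    using fin finite_nonadjacent_pairs[OF finite_verts]
    by (subst card_Un_disjoint) (auto simp: nonadjacent_pairs_def)
  also have "arcs_ends G \<union> nonadjacent_pairs G ?V = (SIGMA v:?V. ?V - {v})"
    by (auto simp: nonadjacent_pairs_def not_adj_self dest: adj_in_verts)
  also have "card \<dots> = card ?V * (card ?V - 1)"
    by (subst card_SigmaI) auto
  finally show ?thesis .
qed

section \<open>Disjoint non-edges in a graph without induced 4-cycles\<close>

text \<open>Take a maximal family \<open>M\<close> of disjoint non-edges in \<open>S\<close>, let
  \<open>m\<close> be its size and \<open>C\<close> the set it leaves uncovered. The square arises
  by assigning to each \<open>(e, f)\<close> in \<open>M \<times> M\<close> its own non-adjacent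
  pair leading from \<open>e\<close> to \<open>f\<close>.\<close>

lemma exists_clique_and_disjoint_nonadjacent_pairs:
  assumes no_K22: "\<not> (\<exists>H. induced_subgraph H G \<and> K\<^bsub>2,2\<^esub> H)" and "finite S"
  obtains C m where "C \<subseteq> S" "pairwise (\<lambda>u v. u \<rightarrow>\<^bsub>G\<^esub> v) C" "card S \<le> card C + 2 * m"
    "m\<^sup>2 \<le> card (nonadjacent_pairs G S)"
proof -
  define E where "E = (\<lambda>(x, y). {x, y}) ` nonadjacent_pairs G S"
  have E_I: "{x, y} \<in> E" if "x \<in> S" "y \<in> S" "x \<noteq> y" "\<not> x \<rightarrow>\<^bsub>G\<^esub> y" for x y
    using that by (force simp: E_def nonadjacent_pairs_def)
  have finE: "finite E"
    unfolding E_def using \<open>finite S\<close> by (simp add: finite_nonadjacent_pairs)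
  let ?A = "{M. M \<subseteq> E \<and> disjoint M}"
  have "finite ?A" using finE by simp
  moreover have "{} \<in> ?A" by simp
  then have "?A \<noteq> {}" by (rule ex_in_conv[THEN iffD1, OF exI])
  ultimately have "\<exists>M\<in>?A. \<forall>M'\<in>?A. M \<subseteq> M' \<longrightarrow> M = M'" by (rule finite_has_maximal)
  then obtain M where "M \<in> ?A" and "\<forall>M'\<in>?A. M \<subseteq> M' \<longrightarrow> M = M'"
    by (rule bexE)
  then have M: "M \<subseteq> E" "disjoint M"
    and max: "\<And>M'. M' \<subseteq> E \<Longrightarrow> disjoint M' \<Longrightarrow> M \<subseteq> M' \<Longrightarrow> M = M'"
    by simp_all
  have finM: "finite M" using M(1) finE by (rule finite_subset)
  define C where "C = S - \<Union>M"
  have "pairwise (\<lambda>u v. u \<rightarrow>\<^bsub>G\<^esub> v) C"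
  proof (rule pairwiseI, rule ccontr)
    fix u v assume uv: "u \<in> C" "v \<in> C" "u \<noteq> v" "\<not> u \<rightarrow>\<^bsub>G\<^esub> v"
    \<comment> \<open>The uncovered non-edge \<open>{u, v}\<close> is disjoint from all members of
      \<open>M\<close>, so maximality puts it into \<open>M\<close>, although \<open>u\<close> is
      uncovered.\<close>
    then have "M = insert {u, v} M"
      using M E_I[of u v] by (intro max) (auto simp: C_def pairwise_insert disjnt_def)
    then show False using uv by (auto simp: C_def)
  qed
  moreover have "card S \<le> card C + 2 * card M"
  proof -
    have "card (\<Union>M) \<le> (\<Sum>e\<in>M. card e)"
      by (rule card_Union_le_sum_card)
    also have "\<dots> \<le> (\<Sum>e\<in>M. 2)"
      using M(1) by (intro sum_mono) (auto simp: E_def card_insert_if)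
    finally have "card (\<Union>M) \<le> 2 * card M" by simp
    moreover have "finite (\<Union>M)"
      using finM M(1) by (auto simp: E_def)
    then have "card S \<le> card (C \<union> \<Union>M)"
      unfolding C_def using \<open>finite S\<close> by (intro card_mono) auto
    then have "card S \<le> card C + card (\<Union>M)"
      using card_Un_le le_trans by blast
    ultimately show ?thesis by linarith
  qed
  moreover have "(card M)\<^sup>2 \<le> card (nonadjacent_pairs G S)"
  proof -
    have "\<exists>p. p \<in> nonadjacent_pairs G S \<and> fst p \<in> e \<and> snd p \<in> f"
      if e: "e \<in> M" and f: "f \<in> M" for e f
    proof -
      obtain a b where ab: "e = {a, b}" "(a, b) \<in> nonadjacent_pairs G S"
        using subsetD[OF M(1) e] by (auto simp: E_def)
      obtain c d where cd: "f = {c, d}" "(c, d) \<in> nonadjacent_pairs G S"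
        using subsetD[OF M(1) f] by (auto simp: E_def)
      show ?thesis
      proof (cases "e = f")
        case True
        \<comment> \<open>On the diagonal the non-edge itself serves.\<close>
        then show ?thesis using ab by (intro exI[of _ "(a, b)"]) auto
      next
        case False
        then have "e \<inter> f = {}" using M(2) e f by (auto simp: disjoint_def)
        \<comment> \<open>If every vertex of \<open>e\<close> were adjacent to every vertex of
          \<open>f\<close>, the two non-edges would be the sides of an induced 4-cycle.\<close>
        moreover obtain x y where "x \<in> e" "y \<in> f" "\<not> x \<rightarrow>\<^bsub>G\<^esub> y"
          using no_K22 induced_K22[of a b c d] ab cd unfolding nonadjacent_pairs_def by blast
        ultimately show ?thesis
          using ab cd by (intro exI[of _ "(x, y)"]) (auto simp: nonadjacent_pairs_def)
      qed
    qed
    then obtain p where p: "\<And>e f. e \<in> M \<Longrightarrow> f \<in> M \<Longrightarrow>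
        p e f \<in> nonadjacent_pairs G S \<and> fst (p e f) \<in> e \<and> snd (p e f) \<in> f"
      by metis
    have "inj_on (\<lambda>(e, f). p e f) (M \<times> M)"
    proof (rule inj_onI, clarsimp)
      fix e f e' f' assume *: "e \<in> M" "f \<in> M" "e' \<in> M" "f' \<in> M" "p e f = p e' f'"
      \<comment> \<open>The first entry of the common value lies in \<open>e\<close> and
        \<open>e'\<close>, the second in \<open>f\<close> and \<open>f'\<close>; disjoint members
        that meet are equal.\<close>
      then have "e \<inter> e' \<noteq> {}" "f \<inter> f' \<noteq> {}"
        using p[of e f] p[of e' f'] by auto
      then show "e = e' \<and> f = f'"
        using * M(2) by (auto simp: disjoint_def)
    qed
    moreover have "(\<lambda>(e, f). p e f) ` (M \<times> M) \<subseteq> nonadjacent_pairs G S"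
      using p by auto
    ultimately have "card (M \<times> M) \<le> card (nonadjacent_pairs G S)"
      using finite_nonadjacent_pairs[OF \<open>finite S\<close>] by (rule card_inj_on_le)
    then show ?thesis by (simp add: power2_eq_square card_cartesian_product)
  qed
  ultimately show ?thesis
    using that[of C "card M"] by (auto simp: C_def)
qed

text \<open>Double counting of a vertex together with a non-adjacent pair of its neighbours: the
  common neighbours of such a pair form a clique, as two non-adjacent ones would complete an induced
  4-cycle.\<close>

lemma sum_nonadjacent_pairs_neighbours:
  assumes no_K22: "\<not> (\<exists>H. induced_subgraph H G \<and> K\<^bsub>2,2\<^esub> H)"
  shows "(\<Sum>v\<in>verts G. card (nonadjacent_pairs G {u. v \<rightarrow>\<^bsub>G\<^esub> u}))
    \<le> clique_number G * card (nonadjacent_pairs G (verts G))"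
proof -
  let ?N = "nonadjacent_pairs G (verts G)"
  let ?R = "\<lambda>v p. v \<rightarrow>\<^bsub>G\<^esub> fst p \<and> v \<rightarrow>\<^bsub>G\<^esub> snd p"
  have finN: "finite ?N" by (simp add: finite_nonadjacent_pairs)
  have "nonadjacent_pairs G {u. v \<rightarrow>\<^bsub>G\<^esub> u} = {p \<in> ?N. ?R v p}" for v
    by (auto simp: nonadjacent_pairs_def dest: adj_in_verts)
  then have "(\<Sum>v\<in>verts G. card (nonadjacent_pairs G {u. v \<rightarrow>\<^bsub>G\<^esub> u}))
      = (\<Sum>v\<in>verts G. card {p \<in> ?N. ?R v p})"
    by simp
  also have "\<dots> = (\<Sum>p\<in>?N. card {v \<in> verts G. ?R v p})"
    using finN by (intro sum_multicount_gen) auto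
  also have "\<dots> \<le> (\<Sum>p\<in>?N. clique_number G)"
  proof (intro sum_mono card_clique_le_clique_number pairwiseI)
    fix p u v
    assume "p \<in> ?N" "u \<in> {v \<in> verts G. ?R v p}" "v \<in> {v \<in> verts G. ?R v p}" "u \<noteq> v"
    then show "u \<rightarrow>\<^bsub>G\<^esub> v"
      using no_K22 induced_K22[of u v "fst p" "snd p"]
      by (simp add: nonadjacent_pairs_def case_prod_beta) blast
  qed auto
  finally show ?thesis by (simp add: mult.commute)
qed

text \<open>The clique left uncovered in the neighbourhood of \<open>v\<close> can be enlarged by
  \<open>v\<close> itself. This gives the \<open>+ 1\<close>, which later turns \<open>n - 1\<close>
  into \<open>n\<close>.\<close>

lemma exists_neighbour_matching_sizes:
  assumes no_K22: "\<not> (\<exists>H. induced_subgraph H G \<and> K\<^bsub>2,2\<^esub> H)"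
  obtains m :: "'a \<Rightarrow> nat"
  where "\<And>v. v \<in> verts G \<Longrightarrow> card {u. v \<rightarrow>\<^bsub>G\<^esub> u} + 1 \<le> clique_number G + 2 * m v"
    and "\<And>v. v \<in> verts G \<Longrightarrow> (m v)\<^sup>2 \<le> card (nonadjacent_pairs G {u. v \<rightarrow>\<^bsub>G\<^esub> u})"
proof -
  have "\<exists>m. card {u. v \<rightarrow>\<^bsub>G\<^esub> u} + 1 \<le> clique_number G + 2 * m \<and>
      m\<^sup>2 \<le> card (nonadjacent_pairs G {u. v \<rightarrow>\<^bsub>G\<^esub> u})" if v: "v \<in> verts G" for v
  proof -
    let ?S = "{u. v \<rightarrow>\<^bsub>G\<^esub> u}"
    have sub: "?S \<subseteq> verts G" by (auto dest: adj_in_verts)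
    then have fin: "finite ?S" using finite_verts by (rule finite_subset)
    obtain C m where C: "C \<subseteq> ?S" "pairwise (\<lambda>u v. u \<rightarrow>\<^bsub>G\<^esub> v) C" "card ?S \<le> card C + 2 * m"
      and m: "m\<^sup>2 \<le> card (nonadjacent_pairs G ?S)"
      using exists_clique_and_disjoint_nonadjacent_pairs[OF no_K22 fin] .
    have "v \<notin> C" using C(1) not_adj_self by auto
    moreover have "finite C" using C(1) fin by (rule finite_subset)
    moreover have "pairwise (\<lambda>u v. u \<rightarrow>\<^bsub>G\<^esub> v) (insert v C)"
      using C(1,2) adj_commute by (auto simp: pairwise_insert)
    then have "card (insert v C) \<le> clique_number G"
      using C(1) sub v by (intro card_clique_le_clique_number) auto
    ultimately show ?thesis using C(3) m by (intro exI[of _ m]) auto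
  qed
  then show ?thesis using that by metis
qed

end

section \<open>Real inequalities and the final estimate\<close>

text \<open>Adding \<open>s\<^sup>2 * n\<close> to both sides of the last hypothesis completes the
  square on the right; then take roots.\<close>

lemma square_one_minus_mult_le:
  fixes s w n :: real
  assumes "0 \<le> s" "0 \<le> w" "0 \<le> n" "s \<le> 1"
    and "(1 - s\<^sup>2) * n \<le> w + 2 * s * sqrt (w * n)"
  shows "(1 - s)\<^sup>2 * n \<le> w"
proof -
  have "(sqrt n)\<^sup>2 \<le> (sqrt w + s * sqrt n)\<^sup>2"
    using assms by (simp add: power2_sum power_mult_distrib real_sqrt_mult algebra_simps)
  then have "sqrt n \<le> sqrt w + s * sqrt n"
    using assms(1-3) by (rule_tac power2_le_imp_le) simp_all
  then have "(1 - s) * sqrt n \<le> sqrt w" by (simp add: algebra_simps)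
  \<comment> \<open>Squaring preserves the inequality because \<open>s \<le> 1\<close> makes the
    left side nonnegative.\<close>
  then have "((1 - s) * sqrt n)\<^sup>2 \<le> (sqrt w)\<^sup>2"
    using assms by (intro power_mono) auto
  then show ?thesis using assms by (simp add: power_mult_distrib)
qed

theorem theorem1:
  fixes G :: "('a, 'b) pre_digraph" and n :: nat and \<alpha> :: real
  assumes "0 < \<alpha>" and "\<alpha> \<le> 1"
    and "graph G"
    and "card (verts G) = n"
    and "real (card (edge_set G)) \<ge> \<alpha> * real (n choose 2)"
    and "\<not> (\<exists>H. induced_subgraph H G \<and> K\<^bsub>2,2\<^esub> H)"
  shows "real (clique_number G) \<ge> (1 - sqrt (1 - \<alpha>))\<^sup>2 * real n"
proof (cases "n = 0")
  case False
  \<comment> \<open>Positivity of \<open>n\<close> makes the natural number \<open>n - 1\<close>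
    agree with the real one and allows dividing by \<open>n\<close> at the end.\<close>
  interpret graph G by fact
  define w where "w = clique_number G"
  define s where "s = sqrt (1 - \<alpha>)"
  have s: "0 \<le> s" "s \<le> 1" "s\<^sup>2 = 1 - \<alpha>"
    using assms(1,2) by (auto simp: s_def)
  define A where "A = card (arcs_ends G)"
  define B where "B = card (nonadjacent_pairs G (verts G))"
  obtain m where m1: "\<And>v. v \<in> verts G \<Longrightarrow> card {u. v \<rightarrow>\<^bsub>G\<^esub> u} + 1 \<le> w + 2 * m v"
    and m2: "\<And>v. v \<in> verts G \<Longrightarrow> (m v)\<^sup>2 \<le> card (nonadjacent_pairs G {u. v \<rightarrow>\<^bsub>G\<^esub> u})"
    unfolding w_def using exists_neighbour_matching_sizes[OF assms(6)] by blast
  define T where "T = (\<Sum>v\<in>verts G. m v)"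
  have n1: "real (n - 1) = real n - 1" using False by simp
  have "2 * (n choose 2) = n * (n - 1)"
    by (cases n) (simp_all add: choose_two)
  then have n2: "2 * real (n choose 2) = real n * (real n - 1)"
    using n1 by (metis of_nat_mult of_nat_numeral)
  have "real A = 2 * real (card (edge_set G))"
    using two_card_edge_set by (simp add: A_def)
  moreover have "\<alpha> * (real n * (real n - 1)) = 2 * (\<alpha> * real (n choose 2))"
    using n2 by simp
  ultimately have A: "\<alpha> * (real n * (real n - 1)) \<le> real A"
    using assms(5) by linarith
  have "real A + real B = real n * (real n - 1)"
    using card_arcs_ends_nonadjacent_pairs assms(4) n1
    unfolding A_def B_def by (metis of_nat_add of_nat_mult)
  then have B: "real B \<le> s\<^sup>2 * (real n * (real n - 1))"
    using A by (simp add: s(3) algebra_simps)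
  have "(\<Sum>v\<in>verts G. card {u. v \<rightarrow>\<^bsub>G\<^esub> u} + 1) \<le> (\<Sum>v\<in>verts G. w + 2 * m v)"
    by (rule sum_mono) (rule m1)
  then have "A + n \<le> w * n + 2 * T"
    using assms(4) by (simp only: sum_card_neighbours A_def T_def sum.distrib sum_distrib_left)
      (simp add: mult.commute)
  then have "real A + real n \<le> real w * real n + 2 * real T"
    by (metis of_nat_add of_nat_le_iff of_nat_mult of_nat_numeral)
  moreover have "real T \<le> s * sqrt (real w * real n) * real n"
  proof -
    have "(\<Sum>v\<in>verts G. (m v)\<^sup>2) \<le> (\<Sum>v\<in>verts G. card (nonadjacent_pairs G {u. v \<rightarrow>\<^bsub>G\<^esub> u}))"
      by (rule sum_mono) (rule m2)
    also have "\<dots> \<le> w * B"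
      using sum_nonadjacent_pairs_neighbours[OF assms(6)] by (simp add: w_def B_def)
    finally have "(\<Sum>v\<in>verts G. (m v)\<^sup>2) \<le> w * B" .
    then have "real (\<Sum>v\<in>verts G. (m v)\<^sup>2) \<le> real (w * B)"
      by (simp only: of_nat_le_iff)
    then have "(\<Sum>v\<in>verts G. (real (m v))\<^sup>2) \<le> real w * real B"
      by simp
    \<comment> \<open>Weakening \<open>n - 1\<close> to \<open>n\<close> makes the bound on
      \<open>(real T)\<^sup>2\<close> a perfect square up to the factor
      \<open>w * n\<close>.\<close>
    also have "\<dots> \<le> real w * (s\<^sup>2 * (real n * real n))"
      using B by (intro mult_left_mono order.trans[OF B]) auto
    \<comment> \<open>Cauchy-Schwarz over the \<open>n\<close> vertices contributes the last factor
      \<open>n\<close>.\<close>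
    finally have "(real T)\<^sup>2 \<le> real w * (s\<^sup>2 * (real n * real n)) * real n"
      using sum_squared_le_sum_of_squares[of "\<lambda>v. real (m v)" "verts G"] assms(4)
      by (simp add: T_def) (meson mult_right_mono of_nat_0_le_iff order.trans)
    also have "\<dots> = (s * sqrt (real w * real n) * real n)\<^sup>2"
      by (simp add: power_mult_distrib power2_eq_square algebra_simps)
    finally show ?thesis
      using s by (rule_tac power2_le_imp_le) auto
  qed
  ultimately have "\<alpha> * (real n * (real n - 1)) + real n
      \<le> real w * real n + 2 * (s * sqrt (real w * real n) * real n)"
    using A by linarith
  then have "(\<alpha> * (real n - 1) + 1) * real n
      \<le> (real w + 2 * s * sqrt (real w * real n)) * real n"
    by (simp add: algebra_simps)
  then have "\<alpha> * (real n - 1) + 1 \<le> real w + 2 * s * sqrt (real w * real n)"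
    using False by simp
  \<comment> \<open>Here \<open>\<alpha> * (n - 1) + 1 = \<alpha> * n + (1 - \<alpha>)\<close>, and
    the last summand is nonnegative.\<close>
  then have "(1 - s\<^sup>2) * real n \<le> real w + 2 * s * sqrt (real w * real n)"
    using assms(2) by (simp add: s(3) algebra_simps)
  then show ?thesis
    using square_one_minus_mult_le[of s "real w" "real n"] s by (simp add: w_def s_def)
qed simp

end
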